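(* Let $y$ be a formal variable. Then $$\sum_{r\ge0}\zeta_{\mathcal{A}}^{(2)}(\{1\}^r)\,y^r=\exp\left\{\sum_{\substack{n\ge1\\ n\ \text{odd}}}\frac{\zeta_{\mathcal{A}}^{(2)}(n)}{n}\,y^n\right\}\quad\text{in }\mathcal{A}[[y]].$$
   Context: Let $\mathcal{P}$ be the set of prime numbers and $\mathcal{A}=\prod_{p\in\mathcal{P}}\mathbb{Z}/p\mathbb{Z}\big/\bigoplus_{p\in\mathcal{P}}\mathbb{Z}/p\mathbb{Z}$, which is a $\mathbb{Q}$-algebra. For a finite sequence of positive integers $(k_1,\ldots,k_r)$, the level-two finite multiple zeta value is $$\zeta_{\mathcal{A}}^{(2)}(k_1,\ldots,k_r)=\left(\sum_{0<n_1<\cdots<n_r<p/2}\frac{1}{n_1^{k_1}\cdots n_r^{k_r}}\bmod p\right)_{p}\in\mathcal{A}.$$ $\{1\}^r$ denotes the sequence consisting of $1$ repeated $r$ times, with the convention $\zeta_{\mathcal{A}}^{(2)}(\{1\}^0)=1$. *)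

theory Defs
  imports
    "HOL-Computational_Algebra.Formal_Power_Series"
    "HOL-Number_Theory.Modular_Inverse"
    "HOL-Library.FuncSet"
begin

section \<open>The product of all prime fields\<close>

text \<open>
  An element is a family indexed by the primes whose entry at \<open>p\<close> is the canonical
  representative in \<open>{0..<p}\<close> of a residue class modulo \<open>p\<close>.
\<close>

typedef prime_prod = "\<Pi>\<^sub>E p\<in>{p::nat. prime p}. {0..<int p}"
  morphisms component Abs_prime_prod
  by (rule exI[of _ "\<lambda>p\<in>{p. prime p}. 0"]) (auto simp: prime_gt_0_nat)

setup_lifting type_definition_prime_prod

lift_definition residues_of :: "(nat \<Rightarrow> int) \<Rightarrow> prime_prod"
  is "\<lambda>a. \<lambda>p\<in>{p. prime p}. a p mod int p"
  by (auto simp: prime_gt_0_nat)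

lemma component_residues_of: "prime p \<Longrightarrow> component (residues_of a) p = a p mod int p"
  by transfer simp

lemma component_mod: "prime p \<Longrightarrow> component x p mod int p = component x p"
  by transfer (auto simp: PiE_iff)

lemma prime_prod_eqI: "(\<And>p. prime p \<Longrightarrow> component x p = component y p) \<Longrightarrow> x = y"
  by transfer (auto intro: PiE_ext)

instantiation prime_prod :: comm_ring_1
begin

definition "0 = residues_of (\<lambda>p. 0)"
definition "1 = residues_of (\<lambda>p. 1)"
definition "x + y = residues_of (\<lambda>p. component x p + component y p)"
definition "x - y = residues_of (\<lambda>p. component x p - component y p)"
definition "- x = residues_of (\<lambda>p. - component x p)"
definition "x * y = residues_of (\<lambda>p. component x p * component y p)"

lemmas prime_prod_ops = zero_prime_prod_def one_prime_prod_def plus_prime_prod_def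
  minus_prime_prod_def uminus_prime_prod_def times_prime_prod_def

instance
proof
  show "(0 :: prime_prod) \<noteq> 1"
  proof
    assume "(0 :: prime_prod) = 1"
    hence "component 0 2 = component 1 2"
      by simp
    thus False
      by (simp add: prime_prod_ops component_residues_of)
  qed
qed (rule prime_prod_eqI,
     simp add: prime_prod_ops component_residues_of component_mod mod_simps algebra_simps)+

end

lemma component_ops:
  assumes "prime p"
  shows "component 0 p = 0" "component 1 p = 1"
    "component (x + y) p = (component x p + component y p) mod int p"
    "component (x - y) p = (component x p - component y p) mod int p"
    "component (- x) p = (- component x p) mod int p"
    "component (x * y) p = (component x p * component y p) mod int p"
  using assms prime_gt_1_nat[OF assms] by (simp_all add: prime_prod_ops component_residues_of)


section \<open>The quotient by the direct sum\<close>

definition direct_sum :: "prime_prod set" where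
  "direct_sum = {x. finite {p. prime p \<and> component x p \<noteq> 0}}"

lemma direct_sum_mono:
  assumes "x \<in> direct_sum" "y \<in> direct_sum"
    "\<And>p. prime p \<Longrightarrow> component x p = 0 \<Longrightarrow> component y p = 0 \<Longrightarrow> component z p = 0"
  shows "z \<in> direct_sum"
proof -
  have "{p. prime p \<and> component z p \<noteq> 0} \<subseteq>
      {p. prime p \<and> component x p \<noteq> 0} \<union> {p. prime p \<and> component y p \<noteq> 0}"
    using assms(3) by blast
  thus ?thesis
    using assms(1,2) unfolding direct_sum_def by (auto intro: finite_subset)
qed

lemma direct_sum_ideal:
  "0 \<in> direct_sum"
  "x \<in> direct_sum \<Longrightarrow> y \<in> direct_sum \<Longrightarrow> x + y \<in> direct_sum"
  "x \<in> direct_sum \<Longrightarrow> y \<in> direct_sum \<Longrightarrow> x - y \<in> direct_sum"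
  "x \<in> direct_sum \<Longrightarrow> - x \<in> direct_sum"
  "x \<in> direct_sum \<Longrightarrow> c * x \<in> direct_sum"
proof -
  show "0 \<in> direct_sum"
    by (simp add: direct_sum_def component_ops cong: conj_cong)
  show "x + y \<in> direct_sum" "x - y \<in> direct_sum"
    if "x \<in> direct_sum" "y \<in> direct_sum"
    by (rule direct_sum_mono[OF that]; simp add: component_ops)+
  show "- x \<in> direct_sum" "c * x \<in> direct_sum" if "x \<in> direct_sum"
    by (rule direct_sum_mono[OF that that]; simp add: component_ops)+
qed

definition adele_rel :: "prime_prod \<Rightarrow> prime_prod \<Rightarrow> bool" where
  "adele_rel x y \<longleftrightarrow> x - y \<in> direct_sum"

lemma equivp_adele_rel: "equivp adele_rel"
proof (rule equivpI)
  show "reflp adele_rel"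
    by (auto simp: reflp_def adele_rel_def direct_sum_ideal)
  show "symp adele_rel"
    unfolding symp_def adele_rel_def by (metis direct_sum_ideal(4) minus_diff_eq)
  show "transp adele_rel"
  proof (rule transpI)
    fix x y z assume "adele_rel x y" "adele_rel y z"
    thus "adele_rel x z"
      unfolding adele_rel_def using direct_sum_ideal(2)[of "x - y" "y - z"] by simp
  qed
qed

text \<open>The ring \<open>\<A>\<close>.\<close>

quotient_type adele = prime_prod / adele_rel
  by (rule equivp_adele_rel)

instantiation adele :: comm_ring_1
begin

lift_definition zero_adele :: adele is 0 .
lift_definition one_adele :: adele is 1 .

lift_definition plus_adele :: "adele \<Rightarrow> adele \<Rightarrow> adele" is "(+)"
proof -
  fix a b c d assume "adele_rel a b" "adele_rel c d"
  thus "adele_rel (a + c) (b + d)"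
    unfolding adele_rel_def using direct_sum_ideal(2)[of "a - b" "c - d"] by (simp add: algebra_simps)
qed

lift_definition minus_adele :: "adele \<Rightarrow> adele \<Rightarrow> adele" is "(-)"
proof -
  fix a b c d assume "adele_rel a b" "adele_rel c d"
  thus "adele_rel (a - c) (b - d)"
    unfolding adele_rel_def using direct_sum_ideal(3)[of "a - b" "c - d"] by (simp add: algebra_simps)
qed

lift_definition uminus_adele :: "adele \<Rightarrow> adele" is uminus
proof -
  fix a b assume "adele_rel a b"
  thus "adele_rel (- a) (- b)"
    unfolding adele_rel_def using direct_sum_ideal(4)[of "a - b"] by (simp add: algebra_simps)
qed

lift_definition times_adele :: "adele \<Rightarrow> adele \<Rightarrow> adele" is "(*)"
proof -
  fix a b c d assume "adele_rel a b" "adele_rel c d"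
  hence "c * (a - b) + b * (c - d) \<in> direct_sum"
    unfolding adele_rel_def by (intro direct_sum_ideal(2,5))
  thus "adele_rel (a * c) (b * d)"
    unfolding adele_rel_def by (simp add: algebra_simps)
qed

instance
proof
  show "(0 :: adele) \<noteq> 1"
  proof (transfer, rule notI)
    assume "adele_rel 0 1"
    moreover have "{p::nat. prime p \<and> component (0 - 1) p \<noteq> 0} = {p. prime p}"
    proof -
      have "component (0 - 1) p \<noteq> 0" if "prime p" for p
        using that prime_gt_1_nat[OF that] by (simp add: component_ops zmod_minus1)
      thus ?thesis by blast
    qed
    ultimately show False
      using primes_infinite by (simp add: adele_rel_def direct_sum_def)
  qed
qed (transfer, simp add: adele_rel_def direct_sum_ideal algebra_simps)+

end

text \<open>The class in \<open>\<A>\<close> of the family \<open>(a p mod p)\<^sub>p\<close>.\<close>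

lift_definition adele_of :: "(nat \<Rightarrow> int) \<Rightarrow> adele" is residues_of .

lemma adele_of_eq_iff:
  "adele_of a = adele_of b \<longleftrightarrow> finite {p. prime p \<and> a p mod int p \<noteq> b p mod int p}"
proof -
  have "prime p \<Longrightarrow> component (residues_of a - residues_of b) p \<noteq> 0 \<longleftrightarrow>
      a p mod int p \<noteq> b p mod int p" for p
    by (auto simp: component_ops component_residues_of mod_simps mod_eq_dvd_iff dvd_eq_mod_eq_0)
  hence "{p. prime p \<and> component (residues_of a - residues_of b) p \<noteq> 0} =
      {p. prime p \<and> a p mod int p \<noteq> b p mod int p}"
    by blast
  thus ?thesis
    by (transfer fixing: a b) (simp add: adele_rel_def direct_sum_def)
qed

lemma adele_of_ops:
  "adele_of (\<lambda>p. 0) = 0" "adele_of (\<lambda>p. 1) = 1"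
  "adele_of (\<lambda>p. a p + b p) = adele_of a + adele_of b"
  "adele_of (\<lambda>p. a p * b p) = adele_of a * adele_of b"
proof -
  have *: "adele_rel x y" if "x = y" for x y
    using that equivp_reflp[OF equivp_adele_rel] by simp
  show "adele_of (\<lambda>p. 0) = 0" "adele_of (\<lambda>p. 1) = 1"
    by (transfer, rule *, simp add: prime_prod_ops)+
  show "adele_of (\<lambda>p. a p + b p) = adele_of a + adele_of b"
    "adele_of (\<lambda>p. a p * b p) = adele_of a * adele_of b"
    by (transfer fixing: a b, rule *, rule prime_prod_eqI,
        simp add: component_ops component_residues_of mod_simps)+
qed


section \<open>The rational algebra structure\<close>

text \<open>
  The rational number \<open>a/b\<close> in lowest terms acts as \<open>a b\<^sup>-\<^sup>1 mod p\<close> at every prime \<open>p\<close> not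
  dividing \<open>b\<close>; the finitely many other primes do not matter.
\<close>

definition rat_adele :: "rat \<Rightarrow> adele" where
  "rat_adele q = adele_of (\<lambda>p. fst (quotient_of q) * modular_inverse (int p) (snd (quotient_of q)))"

lemma finite_prime_dvd:
  assumes "b \<noteq> (0::int)"
  shows "finite {p::nat. prime p \<and> \<not> coprime b (int p)}"
proof (rule finite_subset)
  show "{p::nat. prime p \<and> \<not> coprime b (int p)} \<subseteq> {..nat \<bar>b\<bar>}"
  proof (rule subsetI)
    fix p assume "p \<in> {p::nat. prime p \<and> \<not> coprime b (int p)}"
    hence "prime p" "\<not> coprime b (int p)"
      by simp_all
    hence "int p dvd b"
      by (metis coprime_commute prime_imp_coprime prime_nat_int_transfer)
    with assms have "\<bar>int p\<bar> \<le> \<bar>b\<bar>"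
      by (rule dvd_imp_le_int)
    hence "p \<le> nat \<bar>b\<bar>"
      by linarith
    thus "p \<in> {..nat \<bar>b\<bar>}"
      by simp
  qed
qed simp

lemma rat_adele_eqI:
  assumes q: "q = of_int c / of_int d" "d \<noteq> 0"
    and f: "finite {p. prime p \<and> \<not> [d * f p = c] (mod int p)}"
  shows "rat_adele q = adele_of f"
  unfolding rat_adele_def adele_of_eq_iff
proof (rule finite_subset)
  define a b where "a = fst (quotient_of q)" "b = snd (quotient_of q)"
  hence ab: "quotient_of q = (a, b)"
    by simp
  have "b > 0"
    using ab quotient_of_denom_pos by blast
  have "rat_of_int (a * d) = of_int (c * b)"
    using quotient_of_div[OF ab] q \<open>b > 0\<close> by (simp add: field_simps)
  hence ad: "a * d = c * b"
    by (simp only: of_int_eq_iff)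
  let ?F = "{p. prime p \<and> \<not> [d * f p = c] (mod int p)} \<union>
      ({p. prime p \<and> \<not> coprime b (int p)} \<union> {p. prime p \<and> \<not> coprime d (int p)})"
  show "finite ?F"
    using f finite_prime_dvd[of b] finite_prime_dvd[of d] \<open>b > 0\<close> q(2) by auto
  show "{p. prime p \<and> fst (quotient_of q) * modular_inverse (int p) (snd (quotient_of q)) mod int p
      \<noteq> f p mod int p} \<subseteq> ?F"
  proof (rule subsetI, rule ccontr)
    fix p assume p: "p \<in> {p. prime p \<and>
        fst (quotient_of q) * modular_inverse (int p) (snd (quotient_of q)) mod int p \<noteq> f p mod int p}"
      and "p \<notin> ?F"
    with p have *: "[d * f p = c] (mod int p)" "coprime b (int p)" "coprime d (int p)"
      by auto
    let ?i = "modular_inverse (int p) b"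
    have "d * (a * ?i) = c * (b * ?i)"
      using ad by (metis mult.assoc mult.commute)
    also have "[c * (b * ?i) = c * 1] (mod int p)"
      by (intro cong_mult cong_refl cong_modular_inverse1 *)
    also have "[c * 1 = d * f p] (mod int p)"
      using *(1) by (simp add: cong_sym_eq)
    finally have "[a * ?i = f p] (mod int p)"
      using *(3) by (simp add: cong_mult_lcancel)
    thus False
      using p ab by (simp add: cong_def)
  qed
qed

lemma rat_adele_inverse_component:
  "finite {p. prime p \<and> \<not> [snd (quotient_of q) *
      (fst (quotient_of q) * modular_inverse (int p) (snd (quotient_of q))) = fst (quotient_of q)] (mod int p)}"
    (is "finite ?S")
proof (rule finite_subset)
  show "finite {p. prime p \<and> \<not> coprime (snd (quotient_of q)) (int p)}"
    using quotient_of_denom_pos'[of q] by (intro finite_prime_dvd) simp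
  have "[b * (a * modular_inverse m b) = a] (mod m)" if "coprime b m" for a b m :: int
    using cong_mult[OF cong_refl[of a] cong_modular_inverse1[OF that]] by (simp add: mult_ac)
  thus "?S \<subseteq> {p. prime p \<and> \<not> coprime (snd (quotient_of q)) (int p)}"
    by blast
qed

lemma rat_adele_0 [simp]: "rat_adele 0 = 0"
  using rat_adele_eqI[of 0 0 1 "\<lambda>_. 0"] by (simp add: adele_of_ops)

lemma rat_adele_1 [simp]: "rat_adele 1 = 1"
  using rat_adele_eqI[of 1 1 1 "\<lambda>_. 1"] by (simp add: adele_of_ops)

lemma
  shows rat_adele_add: "rat_adele (q + r) = rat_adele q + rat_adele r" (is ?add)
    and rat_adele_mult: "rat_adele (q * r) = rat_adele q * rat_adele r" (is ?mult)
proof -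
  define a b c d where
    "a = fst (quotient_of q)" "b = snd (quotient_of q)"
    "c = fst (quotient_of r)" "d = snd (quotient_of r)"
  define f where "f = (\<lambda>p::nat. a * modular_inverse (int p) b)"
  define g where "g = (\<lambda>p::nat. c * modular_inverse (int p) d)"
  have pos: "b > 0" "d > 0"
    by (simp_all add: a_b_c_d_def quotient_of_denom_pos')
  have q: "q = of_int a / of_int b" and r: "r = of_int c / of_int d"
    by (simp_all add: a_b_c_d_def quotient_of_div)
  have fin: "finite ({p. prime p \<and> \<not> [b * f p = a] (mod int p)} \<union>
      {p. prime p \<and> \<not> [d * g p = c] (mod int p)})"
    unfolding a_b_c_d_def f_def g_def
    using rat_adele_inverse_component[of q] rat_adele_inverse_component[of r] by simp
  have add: "[b * d * (f p + g p) = a * d + c * b] (mod m)"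
    if "[b * f p = a] (mod m)" "[d * g p = c] (mod m)" for p m
    using cong_add[OF cong_mult[OF that(1) cong_refl[of d]] cong_mult[OF that(2) cong_refl[of b]]]
    by (simp add: algebra_simps)
  have mult: "[b * d * (f p * g p) = a * c] (mod m)"
    if "[b * f p = a] (mod m)" "[d * g p = c] (mod m)" for p m
    using cong_mult[OF that] by (simp add: algebra_simps)
  have fg: "rat_adele q = adele_of f" "rat_adele r = adele_of g"
    by (simp_all add: rat_adele_def f_def g_def a_b_c_d_def)
  have "rat_adele (q + r) = adele_of (\<lambda>p. f p + g p)"
    by (rule rat_adele_eqI[of _ "a * d + c * b" "b * d"])
       (use pos add in \<open>auto simp: q r field_simps intro!: finite_subset[OF _ fin]\<close>)
  thus ?add
    by (simp add: fg adele_of_ops)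
  have "rat_adele (q * r) = adele_of (\<lambda>p. f p * g p)"
    by (rule rat_adele_eqI[of _ "a * c" "b * d"])
       (use pos mult in \<open>auto simp: q r field_simps intro!: finite_subset[OF _ fin]\<close>)
  thus ?mult
    by (simp add: fg adele_of_ops)
qed

definition scale_adele :: "rat \<Rightarrow> adele \<Rightarrow> adele" where
  "scale_adele q x = rat_adele q * x"

lemma vector_space_adele: "vector_space scale_adele"
  by standard (simp_all add: scale_adele_def rat_adele_add rat_adele_mult algebra_simps)

lemma scale_adele_mult: "scale_adele q x * y = scale_adele q (x * y)"
  "x * scale_adele q y = scale_adele q (x * y)"
  by (simp_all add: scale_adele_def mult_ac)


section \<open>The exponential of a formal power series\<close>

text \<open>
  The infinite sum is taken in the \<open>y\<close>-adic topology of \<open>\<A>[[y]]\<close>. It converges if the constant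
  term of the argument vanishes.
\<close>

definition fps_exp_adele :: "adele fps \<Rightarrow> adele fps" where
  "fps_exp_adele F = (\<Sum>m. fps_const (rat_adele (1 / fact m)) * F ^ m)"

lemma
  assumes "fps_nth F 0 = 0"
  shows sums_fps_exp_adele:
      "(\<lambda>m. fps_const (rat_adele (1 / fact m)) * F ^ m) sums fps_exp_adele F"
    and fps_nth_exp_adele:
      "fps_nth (fps_exp_adele F) n = (\<Sum>m\<le>n. scale_adele (1 / fact m) (fps_nth (F ^ m) n))"
proof -
  let ?G = "Abs_fps (\<lambda>n. \<Sum>m\<le>n. scale_adele (1 / fact m) (fps_nth (F ^ m) n))"
  have "(\<lambda>m. fps_const (rat_adele (1 / fact m)) * F ^ m) sums ?G"
    unfolding sums_def
  proof (rule tendsto_fpsI)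
    fix n
    have "fps_nth (\<Sum>m<k. fps_const (rat_adele (1 / fact m)) * F ^ m) n = fps_nth ?G n" if "k > n" for k
    proof -
      have "fps_nth (\<Sum>m<k. fps_const (rat_adele (1 / fact m)) * F ^ m) n =
          (\<Sum>m<k. scale_adele (1 / fact m) (fps_nth (F ^ m) n))"
        by (simp add: fps_sum_nth scale_adele_def)
      also have "\<dots> = (\<Sum>m\<le>n. scale_adele (1 / fact m) (fps_nth (F ^ m) n))"
        using that assms
        by (intro sum.mono_neutral_right) (auto simp: scale_adele_def startsby_zero_power_prefix)
      finally show ?thesis by simp
    qed
    thus "\<forall>\<^sub>F k in sequentially.
        fps_nth (\<Sum>m<k. fps_const (rat_adele (1 / fact m)) * F ^ m) n = fps_nth ?G n"
      using eventually_gt_at_top[of n] by (rule eventually_mono[rotated])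
  qed
  moreover from this have "fps_exp_adele F = ?G"
    unfolding fps_exp_adele_def by (rule sums_unique[symmetric])
  ultimately show
      "(\<lambda>m. fps_const (rat_adele (1 / fact m)) * F ^ m) sums fps_exp_adele F"
      "fps_nth (fps_exp_adele F) n = (\<Sum>m\<le>n. scale_adele (1 / fact m) (fps_nth (F ^ m) n))"
    by simp_all
qed


section \<open>Level-two finite multiple zeta values\<close>

definition index_tuples :: "nat \<Rightarrow> nat \<Rightarrow> nat list set" where
  "index_tuples r p =
     {ns. length ns = r \<and> sorted_wrt (<) ns \<and> (\<forall>n\<in>set ns. 0 < n \<and> 2 * n < p)}"

lemma finite_index_tuples: "finite (index_tuples r p)"
  by (rule finite_subset[OF _ finite_lists_length_eq[of "{..<p}" r]]) (auto simp: index_tuples_def)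

text \<open>
  Every \<open>n\<close> occurring in a tuple is coprime to the prime \<open>p\<close>, so that \<^const>\<open>modular_inverse\<close>
  is a genuine inverse.
\<close>

definition zeta2_mod :: "nat list \<Rightarrow> nat \<Rightarrow> int" where
  "zeta2_mod ks p =
     (\<Sum>ns\<in>index_tuples (length ks) p. \<Prod>i<length ks. modular_inverse (int p) (int (ns ! i)) ^ (ks ! i))"

definition zeta2_adele :: "nat list \<Rightarrow> adele" where
  "zeta2_adele ks = adele_of (zeta2_mod ks)"

lemma zeta2_adele_Nil: "zeta2_adele [] = 1"
proof -
  have "index_tuples 0 p = {[]}" for p
    by (auto simp: index_tuples_def)
  hence "zeta2_mod [] = (\<lambda>p. 1)"
    by (simp add: zeta2_mod_def fun_eq_iff)
  thus ?thesis
    by (simp add: zeta2_adele_def adele_of_ops)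
qed

end

theory Submission
  imports Defs
begin

text \<open>
  Fix a prime \<open>p\<close> and let \<open>x\<^sub>m\<close> be the inverse of \<open>m\<close> modulo \<open>p\<close> for \<open>0 < m < p/2\<close>. Then
  \<open>\<zeta>\<^sup>(\<^sup>2\<^sup>)({1}\<^sup>r)\<close> is the \<open>r\<close>-th elementary symmetric function of the \<open>x\<^sub>m\<close> and
  \<open>\<zeta>\<^sup>(\<^sup>2\<^sup>)(n)\<close> is their \<open>n\<close>-th power sum. Formally
  \<open>\<Prod>(1 + x\<^sub>m y) = exp (\<Sum>\<^sub>n (-1)\<^sup>n\<^sup>-\<^sup>1 (\<Sum>\<^sub>m x\<^sub>m\<^sup>n) y\<^sup>n / n)\<close>, so the claim amounts to the vanishing of
  the even power sums in \<open>\<A>\<close>.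

  The vanishing (\<open>zeta2_adele_even\<close>) comes from a symmetry. The integers \<open>m\<close> with
  \<open>0 < m < p/2\<close> represent the nonzero residues up to sign, and doubling permutes the nonzero
  residues up to sign when \<open>p\<close> is odd. An even power does not see the sign, so the power sum \<open>H\<close>
  of exponent \<open>2k\<close> satisfies \<open>H = 4\<^sup>-\<^sup>k H\<close>; for \<open>k > 0\<close> the integer \<open>4\<^sup>k - 1\<close> is invertible in the
  rational algebra \<open>\<A>\<close>, hence \<open>H = 0\<close>.

  The exponential formula has denominators, which make no sense modulo small primes, so it is split
  into an integral half and a rational half. The integral half is its logarithmic derivative, that
  is, Newton's identities (\<open>newton_identities\<close>); these hold over \<open>\<int>\<close> and pass to \<open>\<A>\<close> entry by
  entry (\<open>zeta2_adele_newton\<close>). Once the even zeta values have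
  vanished, they say that the left-hand side \<open>E\<close> of the theorem satisfies
  \<open>E' = E F'\<close>, where \<open>F\<close> is the argument of the exponential. The rational half is that \<open>exp F\<close> solves
  the same equation (\<open>fps_deriv_exp_adele\<close>) and that a solution over \<open>\<A>\<close> is determined by its
  constant term (\<open>fps_adele_ode_unique\<close>).
\<close>

section \<open>Elementary symmetric functions and power sums\<close>

definition elem_sym :: "('b \<Rightarrow> 'a) \<Rightarrow> 'b set \<Rightarrow> nat \<Rightarrow> 'a :: comm_ring_1" where
  "elem_sym x S r = (\<Sum>X | X \<subseteq> S \<and> card X = r. \<Prod>m\<in>X. x m)"

definition power_sum :: "('b \<Rightarrow> 'a) \<Rightarrow> 'b set \<Rightarrow> nat \<Rightarrow> 'a :: comm_ring_1" where
  "power_sum x S k = (\<Sum>m\<in>S. x m ^ k)"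

lemma fps_const_prod: "fps_const (\<Prod>m\<in>X. x m) = (\<Prod>m\<in>X. fps_const (x m :: 'a :: comm_ring_1))"
  by (induction X rule: infinite_finite_induct) (simp_all flip: fps_const_mult)

lemma prod_one_plus_eq_elem_sym:
  fixes x :: "'b \<Rightarrow> 'a :: comm_ring_1"
  assumes "finite S"
  shows "(\<Prod>m\<in>S. 1 + fps_const (x m) * fps_X) = Abs_fps (elem_sym x S)"
proof (rule fps_ext)
  fix r
  have "(\<Prod>m\<in>S. 1 + fps_const (x m) * fps_X) = (\<Prod>m\<in>S. fps_const (x m) * fps_X + 1)"
    by (simp add: add.commute)
  also have "\<dots> = (\<Sum>X\<in>Pow S. (\<Prod>m\<in>X. fps_const (x m) * fps_X) * (\<Prod>m\<in>S - X. 1))"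
    using assms by (rule prod_add)
  also have "\<dots> = (\<Sum>X\<in>Pow S. fps_const (\<Prod>m\<in>X. x m) * fps_X ^ card X)"
    by (simp add: prod.distrib fps_const_prod)
  finally have "fps_nth (\<Prod>m\<in>S. 1 + fps_const (x m) * fps_X) r =
      (\<Sum>X\<in>Pow S. if card X = r then \<Prod>m\<in>X. x m else 0)"
    by (auto simp: fps_sum_nth fps_X_power_nth intro!: sum.cong)
  also have "\<dots> = (\<Sum>X\<in>{X\<in>Pow S. card X = r}. \<Prod>m\<in>X. x m)"
    using assms by (subst sum.inter_filter) auto
  finally show "fps_nth (\<Prod>m\<in>S. 1 + fps_const (x m) * fps_X) r = fps_nth (Abs_fps (elem_sym x S)) r"
    by (simp add: elem_sym_def)
qed

text \<open>
  The second factor is the geometric series of \<open>c / (1 + c X)\<close>, the logarithmic derivative of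
  \<open>1 + c X\<close>. Multiplying by the series in place of dividing keeps everything over an arbitrary
  commutative ring, in particular over \<open>\<int>\<close>.
\<close>

lemma fps_deriv_one_plus_const_X:
  fixes c :: "'a :: comm_ring_1"
  shows "fps_deriv (1 + fps_const c * fps_X) =
    (1 + fps_const c * fps_X) * Abs_fps (\<lambda>k. (- 1) ^ k * c ^ Suc k)"
proof (rule fps_ext)
  fix n
  show "fps_nth (fps_deriv (1 + fps_const c * fps_X)) n =
      fps_nth ((1 + fps_const c * fps_X) * Abs_fps (\<lambda>k. (- 1) ^ k * c ^ Suc k)) n"
    by (cases n) (simp_all add: ring_distribs mult.assoc mult.left_commute)
qed

lemma fps_deriv_prod_log:
  fixes f g :: "'b \<Rightarrow> 'a :: comm_ring_1 fps"
  assumes "finite S" "\<And>m. m \<in> S \<Longrightarrow> fps_deriv (f m) = f m * g m"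
  shows "fps_deriv (\<Prod>m\<in>S. f m) = (\<Prod>m\<in>S. f m) * (\<Sum>m\<in>S. g m)"
  using assms by (induction S) (simp_all add: algebra_simps)

text \<open>
  The generating function of the elementary symmetric functions is a product of linear factors.
  Summing their logarithmic derivatives gives the generating function of the power sums with
  alternating signs; the identities compare coefficients.
\<close>

lemma newton_identities:
  fixes x :: "'b \<Rightarrow> 'a :: comm_ring_1"
  assumes "finite S"
  shows "of_nat (Suc r) * elem_sym x S (Suc r) =
    (\<Sum>i=0..r. elem_sym x S i * ((- 1) ^ (r - i) * power_sum x S (Suc (r - i))))"
proof -
  have "(\<Sum>m\<in>S. Abs_fps (\<lambda>k. (- 1) ^ k * x m ^ Suc k)) =
      Abs_fps (\<lambda>k. (- 1) ^ k * power_sum x S (Suc k))"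
    by (rule fps_ext) (simp add: fps_sum_nth power_sum_def sum_distrib_left)
  hence "fps_deriv (Abs_fps (elem_sym x S)) =
      Abs_fps (elem_sym x S) * Abs_fps (\<lambda>k. (- 1) ^ k * power_sum x S (Suc k))"
    using fps_deriv_prod_log[OF assms fps_deriv_one_plus_const_X, of x]
    by (simp only: prod_one_plus_eq_elem_sym[OF assms])
  hence "fps_nth (fps_deriv (Abs_fps (elem_sym x S))) r =
      fps_nth (Abs_fps (elem_sym x S) * Abs_fps (\<lambda>k. (- 1) ^ k * power_sum x S (Suc k))) r"
    by simp
  thus ?thesis
    by (simp add: fps_mult_nth)
qed


section \<open>Level-two sums over the lower half of the residues\<close>

definition half_system :: "nat \<Rightarrow> nat set" where
  "half_system p = {m. 0 < m \<and> 2 * m < p}"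

abbreviation inv_mod :: "nat \<Rightarrow> nat \<Rightarrow> int" where
  "inv_mod p m \<equiv> modular_inverse (int p) (int m)"

lemma finite_half_system [simp]: "finite (half_system p)"
  by (rule finite_subset[of _ "{..p}"]) (auto simp: half_system_def)

text \<open>
  A strictly increasing list is determined by its set of entries, so a sum over increasing tuples is
  a sum over subsets of fixed size.
\<close>

lemma zeta2_mod_ones: "zeta2_mod (replicate r 1) p = elem_sym (inv_mod p) (half_system p) r"
proof -
  have "zeta2_mod (replicate r 1) p = (\<Sum>ns\<in>index_tuples r p. \<Prod>m\<in>set ns. inv_mod p m)"
    unfolding zeta2_mod_def
  proof (intro sum.cong)
    fix ns assume "ns \<in> index_tuples r p"
    hence ns: "length ns = r" "distinct ns"
      by (auto simp: index_tuples_def strict_sorted_iff)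
    have "(\<Prod>i<r. inv_mod p (ns ! i)) = (\<Prod>m\<in>set ns. inv_mod p m)"
      using bij_betw_nth[OF ns(2) _ refl, of "{..<r}"] ns(1)
      by (intro prod.reindex_bij_betw) auto
    thus "(\<Prod>i<length (replicate r (1::nat)). inv_mod p (ns ! i) ^ (replicate r 1 ! i)) =
        (\<Prod>m\<in>set ns. inv_mod p m)"
      by simp
  qed simp_all
  also have "\<dots> = elem_sym (inv_mod p) (half_system p) r"
    unfolding elem_sym_def
  proof (rule sum.reindex_bij_betw)
    show "bij_betw set (index_tuples r p) {X. X \<subseteq> half_system p \<and> card X = r}"
    proof (rule bij_betw_byWitness[where f' = sorted_list_of_set])
      show "\<forall>ns\<in>index_tuples r p. sorted_list_of_set (set ns) = ns"
        by (auto simp: index_tuples_def strict_sorted_iff sorted_list_of_set.idem_if_sorted_distinct)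
      show "\<forall>X\<in>{X. X \<subseteq> half_system p \<and> card X = r}. set (sorted_list_of_set X) = X"
        using finite_subset[OF _ finite_half_system] by auto
      show "set ` index_tuples r p \<subseteq> {X. X \<subseteq> half_system p \<and> card X = r}"
        by (auto simp: index_tuples_def half_system_def strict_sorted_iff distinct_card)
      show "sorted_list_of_set ` {X. X \<subseteq> half_system p \<and> card X = r} \<subseteq> index_tuples r p"
      proof (rule image_subsetI)
        fix X assume X: "X \<in> {X. X \<subseteq> half_system p \<and> card X = r}"
        hence "finite X"
          using finite_subset[OF _ finite_half_system] by blast
        with X show "sorted_list_of_set X \<in> index_tuples r p"
          by (auto simp: index_tuples_def half_system_def)
      qed
    qed
  qed
  finally show ?thesis .
qed

lemma zeta2_mod_singleton: "zeta2_mod [k] p = power_sum (inv_mod p) (half_system p) k"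
proof -
  have "zeta2_mod [k] p = (\<Sum>ns\<in>index_tuples 1 p. inv_mod p (hd ns) ^ k)"
    unfolding zeta2_mod_def
    by (intro sum.cong) (auto simp: index_tuples_def length_Suc_conv)
  also have "\<dots> = (\<Sum>m\<in>half_system p. inv_mod p m ^ k)"
    by (rule sum.reindex_bij_betw, rule bij_betw_byWitness[where f' = "\<lambda>m. [m]"])
       (auto simp: index_tuples_def half_system_def length_Suc_conv)
  finally show ?thesis
    by (simp add: power_sum_def)
qed

lemma inv_mod_square_cong:
  assumes "prime p" "0 < m" "m < p" "0 < n" "n < p" "[(int n)\<^sup>2 = c * (int m)\<^sup>2] (mod int p)"
  shows "[c * (inv_mod p n)\<^sup>2 = (inv_mod p m)\<^sup>2] (mod int p)"
proof -
  have inv: "[(int k)\<^sup>2 * (inv_mod p k)\<^sup>2 = 1] (mod int p)" if "0 < k" "k < p" for k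
  proof -
    have "coprime (int k) (int p)"
      using that assms(1) by (metis coprime_commute coprime_int_iff nat_dvd_not_less prime_imp_coprime)
    from cong_pow[OF cong_modular_inverse1[OF this], of 2] show ?thesis
      by (simp add: power_mult_distrib)
  qed
  have "[c * (inv_mod p n)\<^sup>2 * 1 = c * (inv_mod p n)\<^sup>2 * ((int m)\<^sup>2 * (inv_mod p m)\<^sup>2)] (mod int p)"
    using inv[OF assms(2,3)] by (intro cong_mult cong_refl) (rule cong_sym)
  also have "c * (inv_mod p n)\<^sup>2 * ((int m)\<^sup>2 * (inv_mod p m)\<^sup>2) =
      c * (int m)\<^sup>2 * ((inv_mod p n)\<^sup>2 * (inv_mod p m)\<^sup>2)"
    by (simp add: algebra_simps)
  also have "[\<dots> = (int n)\<^sup>2 * ((inv_mod p n)\<^sup>2 * (inv_mod p m)\<^sup>2)] (mod int p)"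
    using assms(6) by (intro cong_mult cong_refl) (rule cong_sym)
  also have "(int n)\<^sup>2 * ((inv_mod p n)\<^sup>2 * (inv_mod p m)\<^sup>2) =
      (int n)\<^sup>2 * (inv_mod p n)\<^sup>2 * (inv_mod p m)\<^sup>2"
    by (simp add: algebra_simps)
  also have "[\<dots> = 1 * (inv_mod p m)\<^sup>2] (mod int p)"
    using inv[OF assms(4,5)] by (intro cong_mult cong_refl)
  finally show ?thesis
    by simp
qed

text \<open>
  Up to sign, this is doubling modulo \<open>p\<close>, with the result brought back into the half system.
\<close>

definition fold_double :: "nat \<Rightarrow> nat \<Rightarrow> nat" where
  "fold_double p m = (if 4 * m < p then 2 * m else p - 2 * m)"

text \<open>
  The two branches of the map have values of different parity because \<open>p\<close> is odd, and each branch is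
  injective. Surjectivity is then automatic on a finite set.
\<close>

lemma bij_betw_fold_double:
  assumes "odd p"
  shows "bij_betw (fold_double p) (half_system p) (half_system p)"
proof -
  have "inj_on (fold_double p) (half_system p)"
  proof (rule inj_onI)
    fix m n assume *: "m \<in> half_system p" "n \<in> half_system p" "fold_double p m = fold_double p n"
    obtain q where "p = 2 * q + 1"
      using assms by (rule oddE)
    with * show "m = n"
      unfolding half_system_def fold_double_def by (simp split: if_splits; presburger)
  qed
  moreover have "fold_double p ` half_system p \<subseteq> half_system p"
  proof (rule image_subsetI)
    fix m assume m: "m \<in> half_system p"
    (* For 4 * m = p the value p - 2 * m would equal p / 2 and lie outside the half system. *)
    have "4 * m \<noteq> p"
      using assms by auto
    with m show "fold_double p m \<in> half_system p"
      by (auto simp: half_system_def fold_double_def)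
  qed
  ultimately show ?thesis
    by (simp add: bij_betw_def endo_inj_surj)
qed

text \<open>
  Reindexing the sum along the doubling permutation replaces each \<open>m\<close> by \<open>\<plusminus> 2 m\<close>, and the square of
  the inverse of \<open>\<plusminus> 2 m\<close> is \<open>1/4\<close> of the square of the inverse of \<open>m\<close>.
\<close>

lemma power_sum_even_cong:
  assumes "prime p" "odd p"
  shows "[4 ^ k * power_sum (inv_mod p) (half_system p) (2 * k) =
    power_sum (inv_mod p) (half_system p) (2 * k)] (mod int p)"
proof -
  have "4 ^ k * power_sum (inv_mod p) (half_system p) (2 * k) =
      (\<Sum>m\<in>half_system p. 4 ^ k * inv_mod p (fold_double p m) ^ (2 * k))"
    unfolding power_sum_def
    by (subst sum.reindex_bij_betw[OF bij_betw_fold_double[OF assms(2)], symmetric])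
       (rule sum_distrib_left)
  also have "[\<dots> = (\<Sum>m\<in>half_system p. inv_mod p m ^ (2 * k))] (mod int p)"
  proof (rule cong_sum)
    fix m assume m: "m \<in> half_system p"
    hence "fold_double p m \<in> half_system p"
      using bij_betwE[OF bij_betw_fold_double[OF assms(2)]] by blast
    moreover have "[(int (fold_double p m))\<^sup>2 = 4 * (int m)\<^sup>2] (mod int p)"
    proof (cases "4 * m < p")
      case True
      thus ?thesis
        by (simp add: fold_double_def power2_eq_square)
    next
      case False
      hence "(int (fold_double p m))\<^sup>2 - 4 * (int m)\<^sup>2 = int p * (int p - 4 * int m)"
        using m by (simp add: fold_double_def half_system_def power2_eq_square of_nat_diff algebra_simps)
      thus ?thesis
        by (simp add: cong_iff_dvd_diff)
    qed
    ultimately have "[4 * (inv_mod p (fold_double p m))\<^sup>2 = (inv_mod p m)\<^sup>2] (mod int p)"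
      using m assms(1) by (intro inv_mod_square_cong) (auto simp: half_system_def)
    hence "[(4 * (inv_mod p (fold_double p m))\<^sup>2) ^ k = ((inv_mod p m)\<^sup>2) ^ k] (mod int p)"
      by (rule cong_pow)
    thus "[4 ^ k * inv_mod p (fold_double p m) ^ (2 * k) = inv_mod p m ^ (2 * k)] (mod int p)"
      by (simp add: power_mult_distrib power_mult)
  qed
  finally show ?thesis
    by (simp add: power_sum_def)
qed


section \<open>Transfer to \<open>\<A>\<close>\<close>

lemma adele_of_sum: "adele_of (\<lambda>p. \<Sum>i\<in>I. a i p) = (\<Sum>i\<in>I. adele_of (a i))"
  by (induction I rule: infinite_finite_induct) (simp_all add: adele_of_ops)

lemma adele_of_of_nat: "adele_of (\<lambda>p. of_nat n) = of_nat n"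
  by (induction n) (simp_all add: adele_of_ops)

lemma adele_of_sign: "adele_of (\<lambda>p. (- 1) ^ n) = (- 1) ^ n"
proof (induction n)
  case (Suc n)
  have "adele_of (\<lambda>p. (- 1) + 1) = adele_of (\<lambda>p. - 1) + 1"
    by (simp only: adele_of_ops)
  hence "adele_of (\<lambda>p. - 1) = - 1"
    by (simp add: adele_of_ops eq_neg_iff_add_eq_0)
  with Suc show ?case
    by (simp only: power_Suc adele_of_ops)
qed (simp add: adele_of_ops)

lemma rat_adele_of_nat: "rat_adele (of_nat n) = of_nat n"
  by (induction n) (simp_all add: rat_adele_add)

lemma of_nat_mult_scale_adele: "n > 0 \<Longrightarrow> of_nat n * scale_adele (q / of_nat n) x = scale_adele q x"
  by (simp add: scale_adele_def flip: rat_adele_of_nat mult.assoc rat_adele_mult)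

text \<open>
  Positive integers are invertible in \<open>\<A>\<close>: this is the form in which the rational structure enters,
  both for the vanishing of even zeta values and for the uniqueness of solutions of differential
  equations.
\<close>

lemma of_nat_mult_left_cancel_adele:
  assumes "of_nat n * x = of_nat n * (y :: adele)" "n > 0"
  shows "x = y"
proof -
  have "scale_adele (1 / of_nat n) (of_nat n * z) = z" for z
    using of_nat_mult_scale_adele[OF assms(2), of 1 z]
    by (simp add: scale_adele_def mult_ac)
  thus ?thesis
    using assms(1) by metis
qed

lemma zeta2_adele_newton:
  "of_nat (Suc r) * zeta2_adele (replicate (Suc r) 1) =
    (\<Sum>i=0..r. zeta2_adele (replicate i 1) * ((- 1) ^ (r - i) * zeta2_adele [Suc (r - i)]))"
proof -
  have "(\<lambda>p. of_nat (Suc r) * zeta2_mod (replicate (Suc r) 1) p) =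
      (\<lambda>p. \<Sum>i=0..r. zeta2_mod (replicate i 1) p * ((- 1) ^ (r - i) * zeta2_mod [Suc (r - i)] p))"
    unfolding zeta2_mod_ones zeta2_mod_singleton newton_identities[OF finite_half_system] ..
  hence "adele_of (\<lambda>p. of_nat (Suc r) * zeta2_mod (replicate (Suc r) 1) p) =
      adele_of (\<lambda>p. \<Sum>i=0..r. zeta2_mod (replicate i 1) p * ((- 1) ^ (r - i) * zeta2_mod [Suc (r - i)] p))"
    by (rule arg_cong)
  thus ?thesis
    unfolding zeta2_adele_def by (simp only: adele_of_ops adele_of_sum adele_of_sign adele_of_of_nat)
qed

text \<open>
  The doubling symmetry is available at every odd prime, and a single prime is invisible in \<open>\<A>\<close>;
  so it gives an exact equation in \<open>\<A>\<close>, where the factor \<open>4\<^sup>k - 1\<close> can be cancelled.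
\<close>

lemma zeta2_adele_even:
  assumes "even n" "n > 0"
  shows "zeta2_adele [n] = 0"
proof -
  obtain k where n: "n = 2 * k"
    using assms(1) by (rule evenE)
  have "{p. prime p \<and> of_nat (4 ^ k) * zeta2_mod [n] p mod int p \<noteq> zeta2_mod [n] p mod int p} \<subseteq> {2}"
  proof (rule subsetI, rule ccontr)
    fix p
    assume p: "p \<in> {p. prime p \<and> of_nat (4 ^ k) * zeta2_mod [n] p mod int p \<noteq> zeta2_mod [n] p mod int p}"
      and "p \<notin> {2}"
    hence "prime p" "odd p"
      using primes_dvd_imp_eq[of 2 p] two_is_prime_nat by auto
    from power_sum_even_cong[OF this, of k] p show False
      by (simp add: n zeta2_mod_singleton cong_def)
  qed
  hence "adele_of (\<lambda>p. of_nat (4 ^ k) * zeta2_mod [n] p) = adele_of (zeta2_mod [n])"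
    unfolding adele_of_eq_iff by (rule finite_subset) simp
  hence *: "of_nat (4 ^ k) * zeta2_adele [n] = zeta2_adele [n]"
    unfolding adele_of_ops adele_of_of_nat zeta2_adele_def .
  have "(1::nat) < 4 ^ k"
    using n assms(2) by (intro one_less_power) auto
  hence "of_nat (4 ^ k) = (of_nat (4 ^ k - 1) + 1 :: adele)"
    by (subst of_nat_diff) simp_all
  with * have "of_nat (4 ^ k - 1) * zeta2_adele [n] = of_nat (4 ^ k - 1) * 0"
    by (simp add: algebra_simps)
  thus ?thesis
    by (rule of_nat_mult_left_cancel_adele) (use \<open>1 < 4 ^ k\<close> in simp)
qed


section \<open>The exponential as the solution of a differential equation\<close>

lemma fps_exp_adele_nth_0: "fps_nth F 0 = 0 \<Longrightarrow> fps_nth (fps_exp_adele F) 0 = 1"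
  by (simp add: fps_nth_exp_adele scale_adele_def)

text \<open>
  Termwise differentiation of the exponential series. It is carried out coefficient by coefficient:
  a coefficient of the exponential is a finite sum, since high powers of \<open>F\<close> do not contribute to it.
\<close>

lemma fps_deriv_exp_adele:
  assumes "fps_nth F 0 = 0"
  shows "fps_deriv (fps_exp_adele F) = fps_exp_adele F * fps_deriv F"
proof (rule fps_ext)
  fix n
  (* One range of summation for all coefficients up to n, so that the sums below can be swapped. *)
  have nth: "fps_nth (fps_exp_adele F) i = (\<Sum>m\<le>n. scale_adele (1 / fact m) (fps_nth (F ^ m) i))"
    if "i \<le> n" for i
    unfolding fps_nth_exp_adele[OF assms]
    using that assms
    by (intro sum.mono_neutral_left) (auto simp: scale_adele_def startsby_zero_power_prefix)
  have deriv: "of_nat (Suc n) * fps_nth (F ^ Suc m) (Suc n) =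
      of_nat (Suc m) * fps_nth (F ^ m * fps_deriv F) n" for m
  proof -
    have "of_nat (Suc n) * fps_nth (F ^ Suc m) (Suc n) = fps_nth (fps_deriv (F ^ Suc m)) n"
      by (simp only: fps_deriv_nth Suc_eq_plus1)
    also have "fps_deriv (F ^ Suc m) = fps_const (of_nat (Suc m)) * (F ^ m * fps_deriv F)"
      by (subst fps_deriv_power) (simp add: mult_ac)
    finally show ?thesis
      by simp
  qed
  have "fps_nth (fps_deriv (fps_exp_adele F)) n =
      of_nat (Suc n) * (\<Sum>m\<le>Suc n. scale_adele (1 / fact m) (fps_nth (F ^ m) (Suc n)))"
    by (simp add: fps_nth_exp_adele[OF assms])
  also have "\<dots> = of_nat (Suc n) * (\<Sum>m\<le>n. scale_adele (1 / fact (Suc m)) (fps_nth (F ^ Suc m) (Suc n)))"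
    by (subst sum.atMost_Suc_shift) (simp add: scale_adele_def)
  also have "\<dots> = (\<Sum>m\<le>n. scale_adele (1 / fact (Suc m)) (of_nat (Suc n) * fps_nth (F ^ Suc m) (Suc n)))"
    by (simp only: sum_distrib_left scale_adele_mult)
  also have "\<dots> = (\<Sum>m\<le>n. scale_adele (1 / fact m) (fps_nth (F ^ m * fps_deriv F) n))"
  proof (rule sum.cong[OF refl])
    fix m
    have "of_nat (Suc m) * scale_adele (1 / fact (Suc m)) z = scale_adele (1 / fact m) z" for z
      using of_nat_mult_scale_adele[of "Suc m" "1 / fact m" z] by (simp add: mult.commute)
    thus "scale_adele (1 / fact (Suc m)) (of_nat (Suc n) * fps_nth (F ^ Suc m) (Suc n)) =
        scale_adele (1 / fact m) (fps_nth (F ^ m * fps_deriv F) n)"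
      unfolding deriv scale_adele_mult(2)[symmetric] by simp
  qed
  also have "\<dots> = (\<Sum>m\<le>n. \<Sum>i=0..n. scale_adele (1 / fact m) (fps_nth (F ^ m) i) * fps_nth (fps_deriv F) (n - i))"
    by (simp add: fps_mult_nth scale_adele_def sum_distrib_left mult.assoc)
  also have "\<dots> = (\<Sum>i=0..n. \<Sum>m\<le>n. scale_adele (1 / fact m) (fps_nth (F ^ m) i) * fps_nth (fps_deriv F) (n - i))"
    by (rule sum.swap)
  also have "\<dots> = fps_nth (fps_exp_adele F * fps_deriv F) n"
    by (simp add: fps_mult_nth nth sum_distrib_right)
  finally show "fps_nth (fps_deriv (fps_exp_adele F)) n = fps_nth (fps_exp_adele F * fps_deriv F) n" .
qed

text \<open>
  The equation determines \<open>n\<close> times the \<open>n\<close>-th coefficient from the lower ones, and \<open>n\<close> can be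
  cancelled.
\<close>

lemma fps_adele_ode_unique:
  fixes G H K :: "adele fps"
  assumes "fps_deriv G = G * K" "fps_deriv H = H * K" "fps_nth G 0 = fps_nth H 0"
  shows "G = H"
proof (rule fps_ext)
  fix n
  show "fps_nth G n = fps_nth H n"
  proof (induction n rule: less_induct)
    case (less n)
    show ?case
    proof (cases n)
      case 0
      thus ?thesis
        using assms(3) by simp
    next
      case (Suc r)
      have "of_nat (Suc r) * fps_nth G (Suc r) = fps_nth (fps_deriv G) r"
        by simp
      also have "\<dots> = (\<Sum>i=0..r. fps_nth G i * fps_nth K (r - i))"
        by (simp add: assms(1) fps_mult_nth)
      also have "\<dots> = (\<Sum>i=0..r. fps_nth H i * fps_nth K (r - i))"
        using less.IH Suc by (intro sum.cong) auto
      also have "\<dots> = fps_nth (fps_deriv H) r"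
        by (simp add: assms(2) fps_mult_nth)
      also have "\<dots> = of_nat (Suc r) * fps_nth H (Suc r)"
        by simp
      finally show ?thesis
        unfolding Suc by (rule of_nat_mult_left_cancel_adele) simp
    qed
  qed
qed


section \<open>The generating function of the values at repeated ones\<close>

theorem corollary3p4:
  shows "Abs_fps (\<lambda>r. zeta2_adele (replicate r 1)) =
    fps_exp_adele
      (Abs_fps (\<lambda>n. if n \<ge> 1 \<and> odd n then scale_adele (1 / of_nat n) (zeta2_adele [n]) else 0))"
proof -
  let ?F = "Abs_fps (\<lambda>n. if n \<ge> 1 \<and> odd n then scale_adele (1 / of_nat n) (zeta2_adele [n]) else 0)"
  let ?E = "Abs_fps (\<lambda>r. zeta2_adele (replicate r 1))"
  (* The signs in Newton's identities are +1 at odd zeta values; the even ones, where the sign would be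
     -1, vanish. Hence the signs may be inserted into F' at no cost. *)
  have F': "fps_nth (fps_deriv ?F) k = (- 1) ^ k * zeta2_adele [Suc k]" for k
  proof (cases "even k")
    case True
    hence "fps_nth (fps_deriv ?F) k = of_nat (Suc k) * scale_adele (1 / of_nat (Suc k)) (zeta2_adele [Suc k])"
      by simp
    also have "\<dots> = zeta2_adele [Suc k]"
      by (subst of_nat_mult_scale_adele) (simp_all add: scale_adele_def)
    finally show ?thesis
      using True by simp
  next
    case False
    thus ?thesis
      by (simp add: zeta2_adele_even)
  qed
  have "fps_deriv ?E = ?E * fps_deriv ?F"
  proof (rule fps_ext)
    fix r
    have "fps_nth (fps_deriv ?E) r = of_nat (Suc r) * zeta2_adele (replicate (Suc r) 1)"
      by simp
    thus "fps_nth (fps_deriv ?E) r = fps_nth (?E * fps_deriv ?F) r"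
      unfolding zeta2_adele_newton fps_mult_nth F' by simp
  qed
  moreover have "fps_nth ?F 0 = 0"
    by simp
  ultimately show ?thesis
    by (intro fps_adele_ode_unique[OF _ fps_deriv_exp_adele])
       (simp_all add: fps_exp_adele_nth_0 zeta2_adele_Nil)
qed

end
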